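(* Let $q$ be a prime power and $n\ge 0$ an integer. Let $g$ be chosen uniformly at random from $GL(n,q)$, and let $Z_n$ be the number of vectors $v\in \mathbb{F}_q^n$ with $gv=v$. Then for every natural number $j$ and every $n\ge j$, $$E[Z_n^j]=\sum_{J=0}^{j}\binom{j}{J}_q,$$ that is, $E[Z_n^j]$ equals the number of subspaces of a $j$-dimensional vector space over $\mathbb{F}_q$.
   Context: The $q$-binomial coefficient is $\binom{j}{J}_q=\frac{(q^j-1)(q^{j-1}-1)\cdots(q^{j-J+1}-1)}{(q^J-1)\cdots(q-1)}$, the number of $J$-dimensional subspaces of $\mathbb{F}_q^j$. *)

theory Defs
  imports
    "HOL-Probability.Probability_Mass_Function"
    "Jordan_Normal_Form.VS_Connect"
begin

definition general_linear :: "nat \<Rightarrow> 'a :: field mat set" where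
  "general_linear n = {g \<in> carrier_mat n n. invertible_mat g}"

text \<open>\<^const>\<open>pmf_of_set\<close> is only meaningful on finite nonempty sets.\<close>

lemma general_linear_nonempty: "general_linear n \<noteq> {}"
proof -
  have "1\<^sub>m n \<in> general_linear n"
    unfolding general_linear_def invertible_mat_def inverts_mat_def
    by (auto intro!: exI[of _ "1\<^sub>m n"])
  then show ?thesis by blast
qed

lemma finite_general_linear: "finite (general_linear n :: 'a :: {field, finite} mat set)"
proof (rule finite_subset)
  let ?D = "{..<n} \<times> {..<n}"
  let ?F = "PiE ?D (\<lambda>_. UNIV :: 'a set)"
  show "general_linear n \<subseteq> (\<lambda>f. mat n n f) ` ?F"
  proof
    fix g :: "'a mat"
    assume "g \<in> general_linear n"
    then have "mat n n (restrict (\<lambda>p. g $$ p) ?D) = g"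
      by (intro eq_matI) (auto simp: general_linear_def)
    then show "g \<in> (\<lambda>f. mat n n f) ` ?F" by (intro image_eqI[OF sym]) (auto simp: PiE_iff extensional_def split: if_splits)
  qed
  show "finite ((\<lambda>f. mat n n f) ` ?F)"
    by (intro finite_imageI finite_PiE) auto
qed

definition num_fixed_vecs :: "'a :: field mat \<Rightarrow> nat" where
  "num_fixed_vecs g = card {v \<in> carrier_vec (dim_row g). g *\<^sub>v v = v}"

text \<open>
  The truncated subtraction \<open>j - i\<close> agrees with the integer one for \<open>J \<le> j\<close>; for \<open>J > j\<close>
  the numerator contains the factor \<open>q ^ 0 - 1 = 0\<close>, as it should.
\<close>

definition q_binomial :: "nat \<Rightarrow> nat \<Rightarrow> nat \<Rightarrow> real" where
  "q_binomial q j J =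
    (\<Prod>i<J. (real q ^ (j - i) - 1)) / (\<Prod>i<J. (real q ^ (J - i) - 1))"

end

theory Submission
  imports Defs
begin

text \<open>
  \<open>Z ^ j\<close> counts the lists of \<open>j\<close> vectors fixed by \<open>g\<close>. Since \<open>GL\<close> acts transitively on the
  linearly independent lists of length \<open>k\<close>, a list of rank \<open>k\<close> is fixed with probability one over
  the number \<open>(q ^ n - 1) \<cdots> (q ^ n - q ^ (k - 1))\<close> of such lists. On the other hand, the number
  of lists of length \<open>j\<close> and rank \<open>k\<close>, divided by this product, satisfies the Pascal rule of the
  \<open>q\<close>-binomial coefficients, so that the expectation becomes their sum. Sorting the
  linearly independent lists by their span shows that these coefficients count the subspaces.
\<close>

section \<open>Linearly independent lists over finite fields\<close>

context vectorspace
begin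

lemma subspace_iff_submodule: "subspace K W V \<longleftrightarrow> submodule K W V"
  using vectorspace_axioms by (auto simp: subspace_def)

text \<open>Coordinates with respect to a finite basis identify the space with the functions from
  the basis to the field; taking extensional functions makes the coefficients unique.\<close>

lemma card_carrier_eq_power_dim:
  assumes fin_dim
  shows "card (carrier V) = card (carrier K) ^ dim"
proof -
  from finite_basis_exists[OF assms] obtain B where B: "finite B" "basis B" by blast
  then have BV: "B \<subseteq> carrier V" by (simp add: basis_def)
  have ex1: "\<exists>!a. a \<in> B \<rightarrow>\<^sub>E carrier K \<and> lincomb a B = v" if "v \<in> carrier V" for v
    using basis_criterion[OF B(1) BV] B(2) that by blast
  have "bij_betw (\<lambda>a. lincomb a B) (B \<rightarrow>\<^sub>E carrier K) (carrier V)"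
    unfolding bij_betw_def
  proof (intro conjI inj_onI Set.set_eqI iffI)
    fix a b assume ab: "a \<in> B \<rightarrow>\<^sub>E carrier K" "b \<in> B \<rightarrow>\<^sub>E carrier K" "lincomb a B = lincomb b B"
    have "lincomb a B \<in> carrier V" using ab(1) BV by auto
    from ex1[OF this] ab show "a = b" by metis
  next
    fix v assume "v \<in> (\<lambda>a. lincomb a B) ` (B \<rightarrow>\<^sub>E carrier K)"
    then show "v \<in> carrier V" using BV by auto
  next
    fix v assume "v \<in> carrier V"
    from ex1[OF this] show "v \<in> (\<lambda>a. lincomb a B) ` (B \<rightarrow>\<^sub>E carrier K)" by blast
  qed
  then have "card (carrier V) = card (B \<rightarrow>\<^sub>E carrier K)"
    using bij_betw_same_card by force
  also have "\<dots> = card (carrier K) ^ card B"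
    using B(1) by (simp add: card_PiE)
  finally show ?thesis using dim_basis[OF B] by simp
qed

definition rank_of :: "'c set \<Rightarrow> nat" where
  "rank_of S = vectorspace.dim K (vs (span S))"

text \<open>Ordered lists make the count a plain product and let matrices act entrywise.
  Independence of \<open>set xs\<close> cannot see repeated entries, hence
  \<open>distinct\<close>.\<close>

definition indep_lists :: "nat \<Rightarrow> 'c list set" where
  "indep_lists k =
    {xs. length xs = k \<and> distinct xs \<and> set xs \<subseteq> carrier V \<and> lin_indpt (set xs)}"

lemma basis_span_vs:
  assumes "S \<subseteq> carrier V" "lin_indpt S"
  shows "vectorspace.basis K (vs (span S)) S"
proof -
  interpret W: vectorspace K "vs (span S)"
    using assms(1) by (intro subspace_is_vs span_is_subspace)
  show ?thesis
    using span_li_not_depend[OF in_own_span span_is_submodule, of S] assms in_own_span[of S]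
    by (simp add: W.basis_def)
qed

text \<open>The recursion behind the counting, the extension to a basis and the invariance under
  matrices. Avoiding the span also rules out a repeated entry, as a set lies in its own
  span.\<close>

lemma indep_lists_Cons:
  "v # xs \<in> indep_lists (Suc k) \<longleftrightarrow>
     xs \<in> indep_lists k \<and> v \<in> carrier V - span (set xs)"
proof
  assume *: "v # xs \<in> indep_lists (Suc k)"
  then have "lin_indpt (set xs)"
    using subset_li_is_li[of "set (v # xs)" "set xs"] by (auto simp: indep_lists_def)
  with * show "xs \<in> indep_lists k \<and> v \<in> carrier V - span (set xs)"
    using lin_dep_iff_in_span[of "set xs" v] by (auto simp: indep_lists_def)
next
  assume *: "xs \<in> indep_lists k \<and> v \<in> carrier V - span (set xs)"
  then have "v \<notin> set xs" using in_own_span[of "set xs"] by (auto simp: indep_lists_def)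
  with * show "v # xs \<in> indep_lists (Suc k)"
    using lin_dep_iff_in_span[of "set xs" v] by (auto simp: indep_lists_def)
qed

lemma indep_lists_0: "indep_lists 0 = {[]}"
  by (auto simp: indep_lists_def lin_dep_def)

end

section \<open>Counting vectors and independent lists over a finite field\<close>

locale finite_vectorspace = vectorspace +
  assumes finite_field: "finite (carrier K)" and fin_dim: fin_dim
begin

abbreviation "q \<equiv> card (carrier K)"

lemma q_ge_2: "q \<ge> 2"
proof -
  have "card {\<zero>\<^bsub>K\<^esub>, \<one>\<^bsub>K\<^esub>} \<le> q" by (rule card_mono) (auto simp: finite_field)
  then show ?thesis by simp
qed

lemma card_carrier: "card (carrier V) = q ^ dim"
  by (rule card_carrier_eq_power_dim[OF fin_dim])

lemma finite_carrier: "finite (carrier V)"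
  using card_carrier q_ge_2 by (intro card_ge_0_finite) simp

text \<open>Makes every counting result available inside subspaces. Finite dimension is immediate
  because the finite set \<open>W\<close> spans itself.\<close>

lemma finite_vectorspace_subspace:
  assumes "submodule K W V"
  shows "finite_vectorspace K (vs W)"
proof -
  interpret W: vectorspace K "vs W"
    using assms by (intro subspace_is_vs) (simp add: subspace_iff_submodule)
  have "W \<subseteq> carrier V" using assms by (rule submodule.subset)
  then have "finite W" using finite_carrier finite_subset by blast
  moreover have "W.span W = W" using W.in_own_span[of W] W.span_is_subset2[of W] by auto
  ultimately have W.fin_dim by (auto simp: W.fin_dim_def)
  then show ?thesis by unfold_locales (auto simp: finite_field)
qed

lemma card_subspace:
  assumes "submodule K W V"
  shows "card W = q ^ vectorspace.dim K (vs W)"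
proof -
  interpret W: finite_vectorspace K "vs W" using assms by (rule finite_vectorspace_subspace)
  show ?thesis using W.card_carrier by simp
qed

lemma card_span: "S \<subseteq> carrier V \<Longrightarrow> card (span S) = q ^ rank_of S"
  unfolding rank_of_def by (intro card_subspace span_is_submodule)

lemma rank_of_indep_list:
  assumes "xs \<in> indep_lists k"
  shows "rank_of (set xs) = k"
proof -
  have S: "set xs \<subseteq> carrier V" "lin_indpt (set xs)" "card (set xs) = k"
    using assms by (auto simp: indep_lists_def distinct_card)
  interpret W: vectorspace K "vs (span (set xs))"
    using S(1) by (intro subspace_is_vs span_is_subspace)
  show ?thesis unfolding rank_of_def
    using W.dim_basis[OF _ basis_span_vs[OF S(1,2)]] S(3) by simp
qed

lemma finite_indep_lists: "finite (indep_lists k)"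
  by (rule finite_subset[OF _ finite_lists_length_eq[OF finite_carrier, of k]])
    (auto simp: indep_lists_def)

text \<open>After \<open>i\<close> independent vectors the next one has to avoid their span, which
  has \<open>q ^ i\<close> elements. For \<open>k > dim\<close> the factor with
  \<open>i = dim\<close> makes the product 0, whatever truncation does to later factors.\<close>

lemma card_indep_lists: "card (indep_lists k) = (\<Prod>i<k. q ^ dim - q ^ i)"
proof (induction k)
  case 0
  show ?case by (simp add: indep_lists_0)
next
  case (Suc k)
  have "indep_lists (Suc k) =
      (\<lambda>(xs, v). v # xs) ` (SIGMA xs:indep_lists k. carrier V - span (set xs))"
  proof (intro Set.set_eqI iffI)
    fix us assume us: "us \<in> indep_lists (Suc k)"
    then obtain v xs where "us = v # xs" by (cases us) (auto simp: indep_lists_def)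
    with us show "us \<in> (\<lambda>(xs, v). v # xs) ` (SIGMA xs:indep_lists k. carrier V - span (set xs))"
      using indep_lists_Cons by auto
  qed (use indep_lists_Cons in auto)
  then have "card (indep_lists (Suc k)) =
      card (SIGMA xs:indep_lists k. carrier V - span (set xs))"
    by (simp add: card_image inj_on_def)
  also have "\<dots> = (\<Sum>xs\<in>indep_lists k. card (carrier V - span (set xs)))"
    using finite_indep_lists finite_carrier by (intro card_SigmaI) auto
  also have "\<dots> = (\<Sum>xs\<in>indep_lists k. q ^ dim - q ^ k)"
  proof (rule sum.cong[OF refl])
    fix xs assume xs: "xs \<in> indep_lists k"
    then have S: "set xs \<subseteq> carrier V" by (simp add: indep_lists_def)
    show "card (carrier V - span (set xs)) = q ^ dim - q ^ k"
      using card_span[OF S] rank_of_indep_list[OF xs] span_is_subset2[OF S]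
        finite_subset[OF span_is_subset2[OF S] finite_carrier]
      by (simp add: card_Diff_subset card_carrier)
  qed
  finally show ?case using Suc.IH by simp
qed

text \<open>Rank and pointwise fixing depend only on the span, so this reduces arbitrary sets to
  independent lists. The list enumerates a basis of \<open>span S\<close> and need not consist of
  elements of \<open>S\<close>.\<close>

lemma ex_indep_list_spanning:
  assumes "S \<subseteq> carrier V"
  shows "\<exists>us\<in>indep_lists (rank_of S). span (set us) = span S"
proof -
  have sub: "submodule K (span S) V" using assms by (rule span_is_submodule)
  interpret W: finite_vectorspace K "vs (span S)"
    using sub by (rule finite_vectorspace_subspace)
  from W.finite_basis_exists[OF W.fin_dim] obtain B where B: "finite B" "W.basis B" by blast
  then have BS: "B \<subseteq> span S" by (simp add: W.basis_def)
  obtain us where us: "set us = B" "distinct us" using finite_distinct_list[OF B(1)] by blast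
  have "span B = span S" "lin_indpt B"
    using B(2) span_li_not_depend[OF BS sub] by (auto simp: W.basis_def)
  moreover have "length us = rank_of S"
    using W.dim_basis[OF B] us distinct_card by (fastforce simp: rank_of_def)
  ultimately show ?thesis using us BS span_is_subset2[OF assms]
    by (intro bexI[of _ us]) (auto simp: indep_lists_def)
qed

text \<open>As long as \<open>m < dim\<close>, the span has only \<open>q ^ m < q ^ dim\<close>
  elements and misses some vector. New vectors go in front, where \<open>indep_lists_Cons\<close>
  applies.\<close>

lemma ex_indep_list_extension:
  assumes "us \<in> indep_lists k" "k \<le> m" "m \<le> dim"
  shows "\<exists>ws. ws @ us \<in> indep_lists m"
  using assms(2,3)
proof (induction m rule: dec_induct)
  case base
  show ?case using assms(1) by (intro exI[of _ "[]"]) simp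
next
  case (step m)
  then obtain ws where ws: "ws @ us \<in> indep_lists m" by auto
  then have S: "set (ws @ us) \<subseteq> carrier V" by (simp add: indep_lists_def)
  have "card (span (set (ws @ us))) < card (carrier V)"
    using card_span[OF S] rank_of_indep_list[OF ws] step.prems q_ge_2
    by (simp add: card_carrier)
  then have "span (set (ws @ us)) \<noteq> carrier V" by (metis less_irrefl)
  then obtain v where "v \<in> carrier V - span (set (ws @ us))"
    using span_is_subset2[OF S] by blast
  then have "(v # ws) @ us \<in> indep_lists (Suc m)" using ws indep_lists_Cons by simp
  then show ?case by blast
qed

section \<open>Counting subspaces\<close>

lemma finite_subspaces: "finite {W. subspace K W V}"
proof (rule finite_subset)
  show "{W. subspace K W V} \<subseteq> Pow (carrier V)"
    using submodule.subset is_module by blast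
qed (simp add: finite_carrier)

text \<open>Independent lists are sorted by their span: those with span \<open>W\<close> are exactly
  the independent lists of length \<open>k\<close> inside \<open>W\<close>, so all fibres have the
  same size. In product form the count covers \<open>k > dim\<close> too, where both sides are
  0.\<close>

lemma card_subspaces_of_dim:
  "card {W. subspace K W V \<and> vectorspace.dim K (vs W) = k} * (\<Prod>i<k. q ^ k - q ^ i) =
     (\<Prod>i<k. q ^ dim - q ^ i)"
proof -
  let ?G = "{W. subspace K W V \<and> vectorspace.dim K (vs W) = k}"
  have fibre: "card {us \<in> indep_lists k. span (set us) = W} = (\<Prod>i<k. q ^ k - q ^ i)"
    if "W \<in> ?G" for W
  proof -
    have sub: "submodule K W V" using that by simp
    interpret W: finite_vectorspace K "vs W" using sub by (rule finite_vectorspace_subspace)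
    have dimW: "W.dim = k" using that by simp
    have "{us \<in> indep_lists k. span (set us) = W} = W.indep_lists k"
    proof (intro Set.set_eqI iffI)
      fix us assume us: "us \<in> {us \<in> indep_lists k. span (set us) = W}"
      then have "set us \<subseteq> W" using in_own_span[of "set us"] by (auto simp: indep_lists_def)
      from span_li_not_depend(2)[OF this sub] this us show "us \<in> W.indep_lists k"
        by (simp add: indep_lists_def W.indep_lists_def)
    next
      fix us assume us: "us \<in> W.indep_lists k"
      then have usW: "set us \<subseteq> W" by (simp add: W.indep_lists_def)
      then have usV: "set us \<subseteq> carrier V" using submodule.subset[OF sub] by blast
      from span_li_not_depend(2)[OF usW sub] us usV have indep: "us \<in> indep_lists k"
        by (simp add: indep_lists_def W.indep_lists_def)
      \<comment> \<open>An independent list of length \<open>dim W\<close> spans \<open>W\<close>,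
        because its span is a subset of \<open>W\<close> with equally many elements.\<close>
      have "span (set us) = W"
      proof (rule card_subset_eq)
        show "finite W" using W.finite_carrier by simp
        show "span (set us) \<subseteq> W" using usW sub by (rule span_is_subset)
        show "card (span (set us)) = card W"
          using card_span[OF usV] rank_of_indep_list[OF indep] card_subspace[OF sub] dimW by simp
      qed
      with indep show "us \<in> {us \<in> indep_lists k. span (set us) = W}" by simp
    qed
    then show ?thesis using W.card_indep_lists[of k] dimW by simp
  qed
  have "indep_lists k = (\<Union>W\<in>?G. {us \<in> indep_lists k. span (set us) = W})"
  proof -
    have "span (set us) \<in> ?G" if "us \<in> indep_lists k" for us
      using that rank_of_indep_list[OF that] span_is_submodule
      by (simp add: subspace_iff_submodule rank_of_def indep_lists_def)
    then show ?thesis by auto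
  qed
  then have "card (indep_lists k) = card (\<Union>W\<in>?G. {us \<in> indep_lists k. span (set us) = W})"
    by simp
  also have "\<dots> = (\<Sum>W\<in>?G. card {us \<in> indep_lists k. span (set us) = W})"
  proof (rule card_UN_disjoint)
    show "finite ?G" by (rule finite_subset[OF _ finite_subspaces]) auto
  qed (auto simp: finite_indep_lists)
  also have "\<dots> = card ?G * (\<Prod>i<k. q ^ k - q ^ i)" using fibre by simp
  finally show ?thesis using card_indep_lists by simp
qed

lemma dim_subspace_le:
  assumes "subspace K W V"
  shows "vectorspace.dim K (vs W) \<le> dim"
proof -
  have "card W \<le> card (carrier V)"
    using finite_carrier submodule.subset[OF is_module[OF assms]] by (rule card_mono)
  then show ?thesis using card_subspace[OF is_module[OF assms]] q_ge_2 by (simp add: card_carrier)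
qed

end

section \<open>Gaussian binomial coefficients\<close>

lemma q_binomial_0 [simp]: "q_binomial q j 0 = 1"
  by (simp add: q_binomial_def)

lemma q_binomial_eq_0: "j < k \<Longrightarrow> q_binomial q j k = 0"
  unfolding q_binomial_def by (auto intro!: bexI[of _ j])

text \<open>Together with the next lemma, a ratio recurrence with cleared denominator, so that the
  Pascal rule can be checked without opening the products. For \<open>j \<le> k\<close> both sides
  are 0, since \<open>j - k\<close> truncates to 0.\<close>

lemma q_binomial_Suc:
  "q_binomial q j (Suc k) * (real q ^ Suc k - 1) = q_binomial q j k * (real q ^ (j - k) - 1)"
  if "q \<ge> 2"
proof -
  have "real q ^ Suc k > 1" using that by (intro one_less_power) auto
  moreover have "(\<Prod>i<Suc k. real q ^ (Suc k - i) - 1) =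
      (real q ^ Suc k - 1) * (\<Prod>i<k. real q ^ (k - i) - 1)"
    by (subst prod.lessThan_Suc_shift) simp
  ultimately show ?thesis by (simp add: q_binomial_def)
qed

lemma q_binomial_Suc_Suc:
  "q_binomial q (Suc j) (Suc k) * (real q ^ Suc k - 1) = q_binomial q j k * (real q ^ Suc j - 1)"
  if "q \<ge> 2"
proof -
  have "real q ^ Suc k > 1" using that by (intro one_less_power) auto
  moreover have P: "(\<Prod>i<Suc k. real q ^ (Suc m - i) - 1) =
      (real q ^ Suc m - 1) * (\<Prod>i<k. real q ^ (m - i) - 1)" for m
    by (subst prod.lessThan_Suc_shift) simp
  ultimately show ?thesis unfolding q_binomial_def P by simp
qed

text \<open>After multiplication by \<open>q ^ Suc k - 1\<close>, the two recurrences express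
  everything through \<open>q_binomial q j k\<close>. Of the two Pascal rules this one fits the rank
  count: \<open>q ^ Suc k\<close> is the number of vectors in a span of rank
  \<open>Suc k\<close>.\<close>

lemma q_binomial_pascal:
  assumes "q \<ge> 2"
  shows "q_binomial q (Suc j) (Suc k) =
    real q ^ Suc k * q_binomial q j (Suc k) + q_binomial q j k"
proof -
  have nz: "real q ^ Suc k - 1 \<noteq> 0"
    using one_less_power[of "real q" "Suc k"] assms by simp
  have "q_binomial q (Suc j) (Suc k) * (real q ^ Suc k - 1) =
      (real q ^ Suc k * q_binomial q j (Suc k) + q_binomial q j k) * (real q ^ Suc k - 1)"
  proof (cases "k \<le> j")
    case True
    have "(real q ^ Suc k * q_binomial q j (Suc k) + q_binomial q j k) * (real q ^ Suc k - 1) =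
        real q ^ Suc k * (q_binomial q j (Suc k) * (real q ^ Suc k - 1)) +
        q_binomial q j k * (real q ^ Suc k - 1)"
      by (simp only: algebra_simps)
    also have "\<dots> = q_binomial q j k * (real q ^ Suc k * real q ^ (j - k) - 1)"
      unfolding q_binomial_Suc[OF assms] by (simp only: algebra_simps)
    also have "real q ^ Suc k * real q ^ (j - k) = real q ^ Suc j"
      using True by (simp flip: power_add)
    finally show ?thesis by (simp only: q_binomial_Suc_Suc[OF assms])
  qed (use q_binomial_Suc_Suc[OF assms, of j k] in \<open>simp add: q_binomial_eq_0\<close>)
  with nz show ?thesis by simp
qed

text \<open>Pulling \<open>q ^ i\<close> out of each factor leaves the same product of powers above
  and below the fraction bar. This form matches the counts of independent lists.\<close>

lemma q_binomial_eq_quotient: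
  assumes "q \<ge> 2" "k \<le> j"
  shows "q_binomial q j k =
    (\<Prod>i<k. real q ^ j - real q ^ i) / (\<Prod>i<k. real q ^ k - real q ^ i)"
proof -
  have *: "(\<Prod>i<k. real q ^ m - real q ^ i) =
      (\<Prod>i<k. real q ^ i) * (\<Prod>i<k. real q ^ (m - i) - 1)" if "k \<le> m" for m
    unfolding prod.distrib[symmetric] using that
    by (intro prod.cong) (auto simp: algebra_simps simp flip: power_add)
  have "(\<Prod>i<k. real q ^ i) \<noteq> 0" using assms by simp
  then show ?thesis using *[of j] *[of k] assms by (simp add: q_binomial_def)
qed

section \<open>Gaussian binomials as subspace counts, and the rank distribution of lists\<close>

context finite_vectorspace
begin

lemma real_prod_q_diff:
  assumes "k \<le> m"
  shows "real (\<Prod>i<k. q ^ m - q ^ i) = (\<Prod>i<k. real q ^ m - real q ^ i)"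
  using assms q_ge_2 by (auto simp: power_increasing intro!: prod.cong)

lemma prod_q_diff_pos:
  assumes "k \<le> m"
  shows "(\<Prod>i<k. real q ^ m - real q ^ i) > 0"
  using assms q_ge_2 by (intro prod_pos) (auto intro!: power_strict_increasing)

lemma card_subspaces_of_dim_eq_q_binomial:
  assumes "k \<le> dim"
  shows "real (card {W. subspace K W V \<and> vectorspace.dim K (vs W) = k}) = q_binomial q dim k"
proof -
  have "real (card {W. subspace K W V \<and> vectorspace.dim K (vs W) = k}) *
      (\<Prod>i<k. real q ^ k - real q ^ i) = (\<Prod>i<k. real q ^ dim - real q ^ i)"
    using arg_cong[OF card_subspaces_of_dim[of k], of real] assms
    by (simp only: of_nat_mult real_prod_q_diff order_refl)
  then show ?thesis
    using assms prod_q_diff_pos[of k k] q_ge_2 by (simp add: q_binomial_eq_quotient field_simps)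
qed

lemma card_subspaces:
  "real (card {W. subspace K W V}) = (\<Sum>k=0..dim. q_binomial q dim k)"
proof -
  have "{W. subspace K W V} =
      (\<Union>k\<in>{0..dim}. {W. subspace K W V \<and> vectorspace.dim K (vs W) = k})"
    using dim_subspace_le by auto
  then have "card {W. subspace K W V} =
      (\<Sum>k=0..dim. card {W. subspace K W V \<and> vectorspace.dim K (vs W) = k})"
    by (simp only:, intro card_UN_disjoint)
      (auto intro: finite_subset[OF _ finite_subspaces])
  then show ?thesis by (simp add: card_subspaces_of_dim_eq_q_binomial)
qed

lemma rank_of_empty [simp]: "rank_of {} = 0"
  using rank_of_indep_list[of "[]" 0] by (simp add: indep_lists_0)

text \<open>For \<open>x\<close> outside the span, \<open>S\<close> is replaced by an independent
  list with the same span; adding \<open>x\<close> keeps the list independent, so its length gives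
  the new rank.\<close>

lemma rank_of_insert:
  assumes S: "S \<subseteq> carrier V" and x: "x \<in> carrier V"
  shows "rank_of (insert x S) = (if x \<in> span S then rank_of S else Suc (rank_of S))"
proof (cases "x \<in> span S")
  case True
  then show ?thesis using already_in_span[OF S True] by (simp add: rank_of_def)
next
  case False
  obtain us where us: "us \<in> indep_lists (rank_of S)" "span (set us) = span S"
    using ex_indep_list_spanning[OF S] by blast
  then have U: "set us \<subseteq> carrier V" by (simp add: indep_lists_def)
  have "x # us \<in> indep_lists (Suc (rank_of S))"
    using us False x by (simp add: indep_lists_Cons)
  from rank_of_indep_list[OF this] have "rank_of (insert x (set us)) = Suc (rank_of S)" by simp
  moreover have "span (insert x (set us)) = span (insert x S)"
    using span_Un[of "{x}" "{x}" "set us" S] us(2) U S x by simp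
  ultimately show ?thesis using False by (simp add: rank_of_def)
qed

lemma rank_of_le: "S \<subseteq> carrier V \<Longrightarrow> rank_of S \<le> dim"
  unfolding rank_of_def using dim_subspace_le span_is_subspace by blast

text \<open>Splits the vectors into those inside and those outside \<open>span S\<close>. The
  arbitrary weight \<open>\<phi>\<close> carries the whole distribution of the new rank in one
  identity.\<close>

lemma sum_rank_of_insert:
  fixes \<phi> :: "nat \<Rightarrow> real"
  assumes S: "S \<subseteq> carrier V"
  shows "(\<Sum>x\<in>carrier V. \<phi> (rank_of (insert x S))) =
    real q ^ rank_of S * \<phi> (rank_of S) +
    (real q ^ dim - real q ^ rank_of S) * \<phi> (Suc (rank_of S))"
proof -
  have sub: "span S \<subseteq> carrier V" using S by (rule span_is_subset2)
  have "(\<Sum>x\<in>carrier V. \<phi> (rank_of (insert x S))) =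
      (\<Sum>x\<in>carrier V - span S. \<phi> (rank_of (insert x S))) +
      (\<Sum>x\<in>span S. \<phi> (rank_of (insert x S)))"
    using sum.subset_diff[OF sub finite_carrier] .
  also have "(\<Sum>x\<in>carrier V - span S. \<phi> (rank_of (insert x S))) =
      real (card (carrier V - span S)) * \<phi> (Suc (rank_of S))"
    using S by (simp add: rank_of_insert)
  also have "(\<Sum>x\<in>span S. \<phi> (rank_of (insert x S))) = real (card (span S)) * \<phi> (rank_of S)"
    using S sub by (simp add: rank_of_insert subset_iff)
  also have "card (carrier V - span S) = q ^ dim - q ^ rank_of S"
    using card_Diff_subset[OF finite_subset[OF sub finite_carrier] sub]
    by (simp only: card_span[OF S] card_carrier)
  also have "real \<dots> = real q ^ dim - real q ^ rank_of S"
    using rank_of_le[OF S] q_ge_2 by (simp add: power_increasing)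
  finally show ?thesis using card_span[OF S] by simp
qed

text \<open>
  Adjoining one vector to a list of rank \<open>k\<close> keeps the rank for \<open>q ^ k\<close> vectors and raises it
  for the others, so the rank distribution obeys the Pascal rule of the \<open>q\<close>-binomials.
\<close>

lemma sum_lists_rank_of:
  fixes \<phi> :: "nat \<Rightarrow> real"
  shows "(\<Sum>xs | set xs \<subseteq> carrier V \<and> length xs = j. \<phi> (rank_of (set xs))) =
    (\<Sum>k\<le>j. q_binomial q j k * (\<Prod>i<k. real q ^ dim - real q ^ i) * \<phi> k)"
proof (induction j arbitrary: \<phi>)
  case 0
  have "{xs. set xs \<subseteq> carrier V \<and> length xs = 0} = {[]}" by auto
  then show ?case by simp
next
  case (Suc j)
  let ?L = "\<lambda>j. {xs. set xs \<subseteq> carrier V \<and> length xs = j}"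
  let ?P = "\<lambda>k. \<Prod>i<k. real q ^ dim - real q ^ i"
  let ?b = "q_binomial q"
  have "?L (Suc j) = (\<lambda>(xs, x). x # xs) ` (?L j \<times> carrier V)"
    by (auto simp: length_Suc_conv image_iff)
  then have "(\<Sum>xs\<in>?L (Suc j). \<phi> (rank_of (set xs))) =
      (\<Sum>(xs, x)\<in>?L j \<times> carrier V. \<phi> (rank_of (insert x (set xs))))"
    by (simp add: sum.reindex inj_on_def case_prod_unfold)
  also have "\<dots> = (\<Sum>xs\<in>?L j. \<Sum>x\<in>carrier V. \<phi> (rank_of (insert x (set xs))))"
    by (rule sum.cartesian_product[symmetric])
  also have "\<dots> = (\<Sum>xs\<in>?L j. real q ^ rank_of (set xs) * \<phi> (rank_of (set xs)) +
      (real q ^ dim - real q ^ rank_of (set xs)) * \<phi> (Suc (rank_of (set xs))))"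
    by (rule sum.cong) (auto intro!: sum_rank_of_insert)
  \<comment> \<open>The induction hypothesis is applied to the weight that results from summing over
    the new vector, hence the generalization over \<open>\<phi>\<close>.\<close>
  also have "\<dots> = (\<Sum>k\<le>j. ?b j k * ?P k *
      (real q ^ k * \<phi> k + (real q ^ dim - real q ^ k) * \<phi> (Suc k)))"
    using Suc.IH[of "\<lambda>r. real q ^ r * \<phi> r + (real q ^ dim - real q ^ r) * \<phi> (Suc r)"] .
  also have "\<dots> = (\<Sum>k\<le>j. real q ^ k * ?b j k * ?P k * \<phi> k) +
      (\<Sum>k\<le>j. ?b j k * ?P (Suc k) * \<phi> (Suc k))"
    unfolding sum.distrib[symmetric] by (rule sum.cong) (simp_all add: algebra_simps)
  \<comment> \<open>The added term \<open>k = Suc j\<close> is 0. Splitting off \<open>k = 0\<close>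
    afterwards aligns this sum with the other one for the Pascal rule.\<close>
  also have "(\<Sum>k\<le>j. real q ^ k * ?b j k * ?P k * \<phi> k) =
      (\<Sum>k\<le>Suc j. real q ^ k * ?b j k * ?P k * \<phi> k)"
    by (simp add: q_binomial_eq_0)
  also have "\<dots> = \<phi> 0 + (\<Sum>k\<le>j. real q ^ Suc k * ?b j (Suc k) * ?P (Suc k) * \<phi> (Suc k))"
    by (subst sum.atMost_Suc_shift) simp
  also have "\<dots> + (\<Sum>k\<le>j. ?b j k * ?P (Suc k) * \<phi> (Suc k)) =
      \<phi> 0 + (\<Sum>k\<le>j. ?b (Suc j) (Suc k) * ?P (Suc k) * \<phi> (Suc k))"
    unfolding add.assoc sum.distrib[symmetric] q_binomial_pascal[OF q_ge_2]
    by (simp only: distrib_right)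
  also have "\<dots> = (\<Sum>k\<le>Suc j. ?b (Suc j) k * ?P k * \<phi> k)"
    by (subst sum.atMost_Suc_shift) simp
  finally show ?case .
qed

end

section \<open>The action of the general linear group\<close>

lemma general_linearI:
  assumes "g \<in> carrier_mat n n" "h \<in> carrier_mat n n" "g * h = 1\<^sub>m n" "h * g = 1\<^sub>m n"
  shows "g \<in> general_linear n"
  using assms by (auto simp: general_linear_def invertible_mat_def inverts_mat_def)

lemma general_linear_carrier: "g \<in> general_linear n \<Longrightarrow> g \<in> carrier_mat n n"
  by (simp add: general_linear_def)

lemma general_linear_inverse:
  assumes "g \<in> general_linear n"
  obtains h where "h \<in> general_linear n" "g * h = 1\<^sub>m n" "h * g = 1\<^sub>m n"
proof -
  from assms obtain h where g: "g \<in> carrier_mat n n"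
    and h: "g * h = 1\<^sub>m (dim_row g)" "h * g = 1\<^sub>m (dim_row h)"
    by (auto simp: general_linear_def invertible_mat_def inverts_mat_def)
  \<comment> \<open>\<open>inverts_mat\<close> leaves the size of \<open>h\<close> open; it is
    recovered by comparing the column counts in the two identities.\<close>
  have "dim_col h = n" using arg_cong[OF h(1), of dim_col] g by simp
  moreover have "dim_row h = n" using arg_cong[OF h(2), of dim_col] g by simp
  ultimately have "h \<in> carrier_mat n n" by blast
  with g h show thesis by (intro that[of h] general_linearI[of h n g]) auto
qed

lemma general_linear_mult:
  assumes g: "g \<in> general_linear n" and h: "h \<in> general_linear n"
  shows "g * h \<in> general_linear n"
proof -
  obtain g' where g': "g' \<in> general_linear n" "g * g' = 1\<^sub>m n" "g' * g = 1\<^sub>m n"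
    using g by (rule general_linear_inverse)
  obtain h' where h': "h' \<in> general_linear n" "h * h' = 1\<^sub>m n" "h' * h = 1\<^sub>m n"
    using h by (rule general_linear_inverse)
  note c = g[THEN general_linear_carrier] h[THEN general_linear_carrier]
    g'(1)[THEN general_linear_carrier] h'(1)[THEN general_linear_carrier]
  have "(g * h) * (h' * g') = g * (h * h') * g'"
    using c by (simp add: assoc_mult_mat[where n\<^sub>1=n and n\<^sub>2=n and n\<^sub>3=n and n\<^sub>4=n])
  moreover have "(h' * g') * (g * h) = h' * (g' * g) * h"
    using c by (simp add: assoc_mult_mat[where n\<^sub>1=n and n\<^sub>2=n and n\<^sub>3=n and n\<^sub>4=n])
  ultimately show ?thesis using c g' h' by (intro general_linearI[of _ n "h' * g'"]) auto
qed

lemma general_linear_inverse_mult_vec: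
  assumes "g \<in> general_linear n"
  obtains h where "h \<in> general_linear n" "g * h = 1\<^sub>m n" "h * g = 1\<^sub>m n"
    "\<forall>v\<in>carrier_vec n. h *\<^sub>v (g *\<^sub>v v) = v"
proof -
  obtain h where h: "h \<in> general_linear n" "g * h = 1\<^sub>m n" "h * g = 1\<^sub>m n"
    using assms by (rule general_linear_inverse)
  note c = assms[THEN general_linear_carrier] h(1)[THEN general_linear_carrier]
  show thesis
    using h c by (intro that[of h]) (simp_all flip: assoc_mult_mat_vec[where n\<^sub>1=n and n\<^sub>2=n and n\<^sub>3=n])
qed

section \<open>Orbits and stabilizers of independent lists\<close>

locale finite_vec_space = vec_space f_ty n for f_ty :: "'a :: {field, finite} itself" and n
begin

sublocale finite_vectorspace class_ring V
  rewrites "carrier V = carrier_vec n"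
    and "carrier (class_ring :: 'a ring) = UNIV"
proof -
  show "finite_vectorspace class_ring V"
    by unfold_locales simp_all
qed simp_all

abbreviation "GL \<equiv> general_linear n :: 'a mat set"

text \<open>The vectors that \<open>g\<close> maps into the span of the image of \<open>S\<close>
  form a subspace containing \<open>S\<close>, hence containing \<open>span S\<close>.\<close>

lemma mult_mat_vec_span:
  assumes g: "g \<in> carrier_mat n n" and S: "S \<subseteq> carrier_vec n" and v: "v \<in> span S"
  shows "g *\<^sub>v v \<in> span ((*\<^sub>v) g ` S)"
proof -
  have gS: "(*\<^sub>v) g ` S \<subseteq> carrier_vec n" using g S by auto
  have "submodule class_ring {v \<in> carrier_vec n. g *\<^sub>v v \<in> span ((*\<^sub>v) g ` S)} V"
  proof (intro submodule.intro)
    show "module class_ring V" by (rule module_axioms)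
    show "\<zero>\<^bsub>V\<^esub> \<in> {v \<in> carrier_vec n. g *\<^sub>v v \<in> span ((*\<^sub>v) g ` S)}"
    proof -
      have "g *\<^sub>v 0\<^sub>v n = 0\<^sub>v n" using g by (intro eq_vecI) auto
      then show ?thesis using span_zero by simp
    qed
  next
    fix v w
    assume "v \<in> {v \<in> carrier_vec n. g *\<^sub>v v \<in> span ((*\<^sub>v) g ` S)}"
      and "w \<in> {v \<in> carrier_vec n. g *\<^sub>v v \<in> span ((*\<^sub>v) g ` S)}"
    then show "v \<oplus>\<^bsub>V\<^esub> w \<in> {v \<in> carrier_vec n. g *\<^sub>v v \<in> span ((*\<^sub>v) g ` S)}"
      using g span_add1[OF gS] by (simp add: mult_add_distrib_mat_vec)
  next
    fix c v
    assume "v \<in> {v \<in> carrier_vec n. g *\<^sub>v v \<in> span ((*\<^sub>v) g ` S)}"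
    then show "c \<odot>\<^bsub>V\<^esub> v \<in> {v \<in> carrier_vec n. g *\<^sub>v v \<in> span ((*\<^sub>v) g ` S)}"
      using g smult_in_span[OF gS] by (simp add: mult_mat_vec)
  qed auto
  moreover have "S \<subseteq> {v \<in> carrier_vec n. g *\<^sub>v v \<in> span ((*\<^sub>v) g ` S)}"
    using S in_own_span[OF gS] by auto
  ultimately show ?thesis using span_is_subset v by blast
qed

text \<open>If \<open>g *\<^sub>v v\<close> were in the span of the images of the later entries,
  applying the inverse would put \<open>v\<close> in the span of those entries.\<close>

lemma general_linear_indep_lists:
  assumes "g \<in> GL"
  shows "us \<in> indep_lists k \<Longrightarrow> map ((*\<^sub>v) g) us \<in> indep_lists k"
proof (induction us arbitrary: k)
  case Nil
  then show ?case by simp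
next
  case (Cons v us)
  obtain h where h: "h \<in> GL" "g * h = 1\<^sub>m n" "h * g = 1\<^sub>m n"
      "\<forall>v\<in>carrier_vec n. h *\<^sub>v (g *\<^sub>v v) = v"
    using assms by (rule general_linear_inverse_mult_vec)
  note c = assms[THEN general_linear_carrier] h(1)[THEN general_linear_carrier]
  obtain l where k: "k = Suc l" using Cons.prems by (cases k) (auto simp: indep_lists_def)
  have us: "us \<in> indep_lists l" "v \<in> carrier_vec n" "v \<notin> span (set us)"
    using Cons.prems by (auto simp: k indep_lists_Cons)
  then have U: "set us \<subseteq> carrier_vec n" by (simp add: indep_lists_def)
  have "g *\<^sub>v v \<notin> span ((*\<^sub>v) g ` set us)"
  proof
    assume "g *\<^sub>v v \<in> span ((*\<^sub>v) g ` set us)"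
    then have "h *\<^sub>v (g *\<^sub>v v) \<in> span ((*\<^sub>v) h ` (*\<^sub>v) g ` set us)"
      by (rule mult_mat_vec_span[rotated 2]) (use c U in auto)
    moreover have "(*\<^sub>v) h ` (*\<^sub>v) g ` set us = (\<lambda>v. v) ` set us"
      unfolding image_image using U h(4) by (intro image_cong) auto
    ultimately show False using us h(4) by simp
  qed
  then show ?case using Cons.IH[OF us(1)] us(2) c by (simp add: k indep_lists_Cons)
qed

text \<open>By cardinality, \<open>n\<close> independent columns span everything, so each unit
  vector is hit. This yields a right inverse, which for square matrices over a field is
  two-sided.\<close>

lemma mat_of_cols_indep_list:
  assumes "us \<in> indep_lists n"
  shows "mat_of_cols n us \<in> GL"
proof -
  let ?P = "mat_of_cols n us"
  have us: "length us = n" "set us \<subseteq> carrier_vec n" using assms by (auto simp: indep_lists_def)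
  then have P: "?P \<in> carrier_mat n n" by auto
  have "span (set us) = carrier_vec n"
  proof (rule card_subset_eq)
    show "card (span (set us)) = card (carrier_vec n :: 'a vec set)"
      using card_span[OF us(2)] rank_of_indep_list[OF assms] card_carrier by (simp add: dim_is_n)
  qed (use finite_carrier span_is_subset2[OF us(2)] in auto)
  then have "col_space ?P = carrier_vec n"
    using us by (simp add: col_space_def)
  then have "unit_vec n i \<in> col_space ?P" for i by simp
  then have "\<exists>c\<in>carrier_vec n. ?P *\<^sub>v c = unit_vec n i" for i
    using col_space_eq[OF P] us(1) by simp
  then obtain c where c: "\<And>i. c i \<in> carrier_vec n" "\<And>i. ?P *\<^sub>v c i = unit_vec n i" by metis
  \<comment> \<open>Column \<open>i\<close> of \<open>Q\<close> is a preimage of the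
    \<open>i\<close>-th unit vector.\<close>
  define Q where "Q = mat_of_cols n (map c [0..<n])"
  have Q: "Q \<in> carrier_mat n n" by (simp add: Q_def mat_of_cols_carrier[of n "map c [0..<n]", simplified])
  have "?P * Q = 1\<^sub>m n"
  proof (rule mat_col_eqI)
    fix i assume "i < dim_col (1\<^sub>m n :: 'a mat)"
    then have i: "i < n" by simp
    have "col (?P * Q) i = ?P *\<^sub>v col Q i" using P Q i by (rule col_mult2)
    also have "col Q i = c i" using i c(1) by (simp add: Q_def)
    finally show "col (?P * Q) i = col (1\<^sub>m n) i" using i c(2) by simp
  qed (use P Q in auto)
  with mat_mult_left_right_inverse[OF P Q] show ?thesis by (intro general_linearI[OF P Q])
qed

text \<open>Both lists are extended to bases; with these as columns of \<open>P\<close> and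
  \<open>Q\<close>, the matrix \<open>Q\<close> times the inverse of \<open>P\<close> carries the
  first basis to the second.\<close>

lemma general_linear_transitive:
  assumes us: "us \<in> indep_lists k" and ws: "ws \<in> indep_lists k"
  shows "\<exists>g\<in>GL. map ((*\<^sub>v) g) us = ws"
proof -
  have "k \<le> n"
    using rank_of_indep_list[OF us] rank_of_le[of "set us"] us
    by (auto simp: indep_lists_def dim_is_n)
  obtain us' where us': "us' @ us \<in> indep_lists n"
    using ex_indep_list_extension[OF us \<open>k \<le> n\<close>] by (auto simp: dim_is_n)
  obtain ws' where ws': "ws' @ ws \<in> indep_lists n"
    using ex_indep_list_extension[OF ws \<open>k \<le> n\<close>] by (auto simp: dim_is_n)
  let ?us = "us' @ us" and ?ws = "ws' @ ws"
  let ?P = "mat_of_cols n ?us" and ?Q = "mat_of_cols n ?ws"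
  have P: "?P \<in> GL" and Q: "?Q \<in> GL" using us' ws' by (auto intro: mat_of_cols_indep_list)
  obtain P' where P': "P' \<in> GL" "P' * ?P = 1\<^sub>m n"
    using P by (rule general_linear_inverse)
  note c = P[THEN general_linear_carrier] Q[THEN general_linear_carrier]
    P'(1)[THEN general_linear_carrier]
  let ?g = "?Q * P'"
  have g: "?g \<in> GL" using Q P'(1) by (rule general_linear_mult)
  have gP: "?g * ?P = ?Q" using assoc_mult_mat[OF c(2) c(3) c(1)] P'(2) right_mult_one_mat[OF c(2)] by simp
  have len: "length ?us = n" "length ?ws = n" "length us = k" "length ws = k"
    using us us' ws ws' by (auto simp: indep_lists_def)
  have "map ((*\<^sub>v) ?g) ?us = ?ws"
  proof (rule nth_equalityI)
    fix i assume "i < length (map ((*\<^sub>v) ?g) ?us)"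
    then have i: "i < n" using len by simp
    have "?us ! i \<in> set ?us" "?ws ! i \<in> set ?ws" using i len by (auto simp only: nth_mem)
    then have vec: "?us ! i \<in> carrier_vec n" "?ws ! i \<in> carrier_vec n"
      using us' ws' unfolding indep_lists_def by blast+
    have "?g *\<^sub>v (?us ! i) = ?g *\<^sub>v col ?P i" using vec i len by (subst col_mat_of_cols) auto
    also have "\<dots> = col (?g * ?P) i"
      using g[THEN general_linear_carrier] c i by (intro col_mult2[symmetric]) auto
    also have "\<dots> = ?ws ! i" unfolding gP using vec i len by (intro col_mat_of_cols) auto
    finally show "map ((*\<^sub>v) ?g) ?us ! i = ?ws ! i" using i len by (simp del: map_append)
  qed (use len in simp)
  \<comment> \<open>As \<open>us\<close> and \<open>ws\<close> have the same length, equality of the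
    extended lists gives equality of these tails.\<close>
  then have "map ((*\<^sub>v) ?g) us = ws"
    using len by simp
  with g show ?thesis by blast
qed

text \<open>Orbit-stabilizer: by transitivity the orbit of \<open>us\<close> is all of
  \<open>indep_lists k\<close>, and left multiplication by a matrix taking \<open>us\<close> to
  \<open>ws\<close> maps the stabilizer bijectively onto the matrices doing the same.\<close>

lemma card_stabilizer:
  assumes us: "us \<in> indep_lists k"
  shows "card {g \<in> GL. map ((*\<^sub>v) g) us = us} * card (indep_lists k) = card GL"
proof -
  let ?F = "\<lambda>ws. {g \<in> GL. map ((*\<^sub>v) g) us = ws}"
  have U: "set us \<subseteq> carrier_vec n" using us by (simp add: indep_lists_def)
  have fin: "finite GL" by (rule finite_general_linear)
  have map_mult: "map ((*\<^sub>v) (a * b)) us = map ((*\<^sub>v) a) (map ((*\<^sub>v) b) us)"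
    if "a \<in> GL" "b \<in> GL" for a b
    using U that[THEN general_linear_carrier]
    by (auto intro!: assoc_mult_mat_vec[where n\<^sub>1=n and n\<^sub>2=n and n\<^sub>3=n])
  have fibre: "card (?F ws) = card (?F us)" if ws: "ws \<in> indep_lists k" for ws
  proof -
    obtain h where h: "h \<in> GL" "map ((*\<^sub>v) h) us = ws"
      using general_linear_transitive[OF us ws] by blast
    obtain h' where h': "h' \<in> GL" "h * h' = 1\<^sub>m n" "h' * h = 1\<^sub>m n"
      "\<forall>v\<in>carrier_vec n. h' *\<^sub>v (h *\<^sub>v v) = v"
      using h(1) by (rule general_linear_inverse_mult_vec)
    have h'_ws: "map ((*\<^sub>v) h') ws = us" unfolding h(2)[symmetric] using U h'(4)
      by (auto intro!: map_idI)
    have cancel: "h * (h' * g) = g" "h' * (h * g) = g" if "g \<in> GL" for g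
      using that[THEN general_linear_carrier] h(1)[THEN general_linear_carrier]
        h'(1)[THEN general_linear_carrier] h'(2,3)
      by (simp_all flip: assoc_mult_mat[where n\<^sub>1=n and n\<^sub>2=n and n\<^sub>3=n and n\<^sub>4=n])
    have "bij_betw ((*) h) (?F us) (?F ws)"
      by (rule bij_betwI[where g = "(*) h'"])
        (use h h' h'_ws cancel in \<open>auto simp: map_mult general_linear_mult simp del: map_map\<close>)
    then show ?thesis by (simp add: bij_betw_same_card)
  qed
  have "GL = (\<Union>ws\<in>indep_lists k. ?F ws)"
    using general_linear_indep_lists us by auto
  then have "card GL = card (\<Union>ws\<in>indep_lists k. ?F ws)" by simp
  also have "\<dots> = (\<Sum>ws\<in>indep_lists k. card (?F ws))"
    by (rule card_UN_disjoint) (use fin finite_indep_lists in auto)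
  also have "\<dots> = (\<Sum>ws\<in>indep_lists k. card (?F us))" using fibre by (intro sum.cong) auto
  finally show ?thesis by simp
qed

text \<open>The vectors fixed by a matrix form a subspace. Fixing \<open>S\<close> pointwise is
  therefore the same as fixing an independent list with the same span, and the stabilizer count
  applies.\<close>

lemma card_fixing:
  assumes S: "S \<subseteq> carrier_vec n"
  shows "real (card {g \<in> GL. \<forall>v\<in>S. g *\<^sub>v v = v}) =
    real (card GL) / (\<Prod>i<rank_of S. real CARD('a) ^ n - real CARD('a) ^ i)"
proof -
  obtain us where us: "us \<in> indep_lists (rank_of S)" "span (set us) = span S"
    using ex_indep_list_spanning[OF S] by blast
  have U: "set us \<subseteq> carrier_vec n" using us by (simp add: indep_lists_def)
  have fix_span: "v \<in> span T \<Longrightarrow> g *\<^sub>v v = v"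
    if g: "g \<in> GL" and T: "T \<subseteq> carrier_vec n" "\<forall>v\<in>T. g *\<^sub>v v = v" for g T v
  proof -
    note gc = g[THEN general_linear_carrier]
    have "submodule class_ring {v \<in> carrier_vec n. g *\<^sub>v v = v} V"
      using gc by (intro submodule.intro module_axioms)
        (auto simp: mult_add_distrib_mat_vec mult_mat_vec)
    then have "span T \<subseteq> {v \<in> carrier_vec n. g *\<^sub>v v = v}"
      using T by (intro span_is_subset) auto
    then show "v \<in> span T \<Longrightarrow> g *\<^sub>v v = v" by auto
  qed
  have eq: "{g \<in> GL. \<forall>v\<in>S. g *\<^sub>v v = v} = {g \<in> GL. map ((*\<^sub>v) g) us = us}"
  proof (intro Set.set_eqI iffI)
    fix g assume "g \<in> {g \<in> GL. \<forall>v\<in>S. g *\<^sub>v v = v}"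
    then show "g \<in> {g \<in> GL. map ((*\<^sub>v) g) us = us}"
      using fix_span[of g S] S us(2) span_mem[OF U] by (auto intro!: map_idI)
  next
    fix g assume g: "g \<in> {g \<in> GL. map ((*\<^sub>v) g) us = us}"
    then have "\<forall>v\<in>set us. g *\<^sub>v v = v" by (metis (mono_tags) map_eq_conv mem_Collect_eq list.map_ident)
    with g show "g \<in> {g \<in> GL. \<forall>v\<in>S. g *\<^sub>v v = v}"
      using fix_span[of g "set us"] U us(2) span_mem[OF S] by auto
  qed
  have indep: "real (card (indep_lists (rank_of S))) =
      (\<Prod>i<rank_of S. real CARD('a) ^ n - real CARD('a) ^ i)"
    using rank_of_le[OF S] unfolding card_indep_lists dim_is_n by (rule real_prod_q_diff)
  have pos: "(\<Prod>i<rank_of S. real CARD('a) ^ n - real CARD('a) ^ i) > 0"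
    using rank_of_le[OF S] by (intro prod_q_diff_pos) (simp add: dim_is_n)
  have stab: "real (card {g \<in> GL. map ((*\<^sub>v) g) us = us}) *
      real (card (indep_lists (rank_of S))) = real (card GL)"
    using card_stabilizer[OF us(1)] by (simp flip: of_nat_mult)
  show ?thesis
    unfolding eq by (rule eq_divide_imp[OF less_imp_neq[OF pos, symmetric] stab[unfolded indep]])
qed

section \<open>Moments of the number of fixed vectors\<close>

lemma num_fixed_vecs_power:
  assumes "g \<in> GL"
  shows "num_fixed_vecs g ^ j =
    card {xs. set xs \<subseteq> carrier_vec n \<and> length xs = j \<and> (\<forall>v\<in>set xs. g *\<^sub>v v = v)}"
proof -
  let ?A = "{v \<in> carrier_vec n. g *\<^sub>v v = v}"
  have "num_fixed_vecs g = card ?A"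
    using general_linear_carrier[OF assms] by (simp add: num_fixed_vecs_def)
  moreover have "card {xs. set xs \<subseteq> ?A \<and> length xs = j} = card ?A ^ j"
    using finite_carrier by (intro card_lists_length_eq) simp
  moreover have "{xs. set xs \<subseteq> ?A \<and> length xs = j} =
      {xs. set xs \<subseteq> carrier_vec n \<and> length xs = j \<and> (\<forall>v\<in>set xs. g *\<^sub>v v = v)}"
    by auto
  ultimately show ?thesis by simp
qed

lemma expectation_num_fixed_vecs_power:
  assumes "j \<le> n"
  shows "measure_pmf.expectation (pmf_of_set GL) (\<lambda>g. real (num_fixed_vecs g) ^ j) =
    (\<Sum>k=0..j. q_binomial CARD('a) j k)"
proof -
  let ?L = "{xs :: 'a vec list. set xs \<subseteq> carrier_vec n \<and> length xs = j}"
  let ?P = "\<lambda>k. \<Prod>i<k. real CARD('a) ^ n - real CARD('a) ^ i"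
  have finL: "finite ?L" using finite_carrier by (intro finite_lists_length_eq)
  have fin: "finite GL" by (rule finite_general_linear)
  have GL_pos: "card GL > 0" using fin general_linear_nonempty by (simp add: card_gt_0_iff)
  have "(\<Sum>g\<in>GL. real (num_fixed_vecs g) ^ j) =
      (\<Sum>g\<in>GL. real (card {xs \<in> ?L. \<forall>v\<in>set xs. g *\<^sub>v v = v}))"
    by (intro sum.cong refl) (simp add: num_fixed_vecs_power flip: of_nat_power)
  \<comment> \<open>Double counting of the pairs of a matrix and a list that it fixes
    entrywise.\<close>
  also have "\<dots> = (\<Sum>xs\<in>?L. real (card {g \<in> GL. \<forall>v\<in>set xs. g *\<^sub>v v = v}))"
    using sum_multicount_gen[OF fin finL, of "\<lambda>g xs. \<forall>v\<in>set xs. g *\<^sub>v v = v"]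
    by (simp flip: of_nat_sum)
  also have "\<dots> = (\<Sum>xs\<in>?L. real (card GL) / ?P (rank_of (set xs)))"
    by (intro sum.cong refl card_fixing) simp
  also have "\<dots> = real (card GL) * (\<Sum>xs\<in>?L. 1 / ?P (rank_of (set xs)))"
    by (simp add: sum_distrib_left)
  \<comment> \<open>The rank distribution is evaluated at the fixing probability
    \<open>1 / ?P r\<close>, whose denominator is the weight \<open>?P r\<close> occurring
    there.\<close>
  also have "(\<Sum>xs\<in>?L. 1 / ?P (rank_of (set xs))) =
      (\<Sum>k\<le>j. q_binomial CARD('a) j k * ?P k * (1 / ?P k))"
    using sum_lists_rank_of[of "\<lambda>r. 1 / ?P r" j] by (simp only: dim_is_n)
  also have "\<dots> = (\<Sum>k=0..j. q_binomial CARD('a) j k)"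
    unfolding atMost_atLeast0
  proof (rule sum.cong[OF refl])
    fix k assume "k \<in> {0..j}"
    \<comment> \<open>Here \<open>j \<le> n\<close> enters: for \<open>k > n\<close> the product
      \<open>?P k\<close> is 0, and with \<open>1 / 0 = 0\<close> the summand would be lost.\<close>
    then have "?P k > 0" using assms by (intro prod_q_diff_pos) simp
    moreover have "b * c * (1 / c) = b" if "c > 0" for b c :: real using that by simp
    ultimately show "q_binomial CARD('a) j k * ?P k * (1 / ?P k) = q_binomial CARD('a) j k" by blast
  qed
  finally show ?thesis
    using GL_pos by (simp add: integral_pmf_of_set[OF general_linear_nonempty fin])
qed

end

theorem theorem4p1:
  fixes q n j :: nat
  assumes q: "q = CARD('a :: {field, finite})"
    and nj: "n \<ge> j"
  shows "measure_pmf.expectation (pmf_of_set (general_linear n :: 'a mat set))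
           (\<lambda>g. real (num_fixed_vecs g) ^ j) = (\<Sum>J=0..j. q_binomial q j J)
       \<and> (\<forall>V :: ('a, 'v) module.
             vectorspace class_ring V \<and> vectorspace.fin_dim class_ring V
               \<and> vectorspace.dim class_ring V = j \<longrightarrow>
             measure_pmf.expectation (pmf_of_set (general_linear n :: 'a mat set))
               (\<lambda>g. real (num_fixed_vecs g) ^ j) =
             real (card {W. subspace class_ring W V}))"
proof (intro conjI allI impI)
  interpret F: finite_vec_space "TYPE('a)" n .
  show moment: "measure_pmf.expectation (pmf_of_set (general_linear n :: 'a mat set))
      (\<lambda>g. real (num_fixed_vecs g) ^ j) = (\<Sum>J=0..j. q_binomial q j J)"
    using F.expectation_num_fixed_vecs_power[OF nj] by (simp add: q)
  fix V :: "('a, 'v) module"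
  assume V: "vectorspace class_ring V \<and> vectorspace.fin_dim class_ring V
    \<and> vectorspace.dim class_ring V = j"
  \<comment> \<open>The subspaces are counted in an arbitrary \<open>j\<close>-dimensional space,
    unrelated to the \<open>n\<close>-dimensional space on which the matrices act; both counts give
    the same sum.\<close>
  interpret V: finite_vectorspace "class_ring :: 'a ring" V
    using V by (simp add: finite_vectorspace_def finite_vectorspace_axioms_def)
  show "measure_pmf.expectation (pmf_of_set (general_linear n :: 'a mat set))
      (\<lambda>g. real (num_fixed_vecs g) ^ j) = real (card {W. subspace class_ring W V})"
    unfolding moment using V.card_subspaces V by (simp add: q)
qed

end
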